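(* Let $ex_3(D_2^3,n)$ denote the maximum number of edges of an $n$-vertex geometric $3$-hypergraph in $3$-space that does not contain two disjoint edges. Then $ex_3(D_2^3,n)=\Theta(n^2)$ as $n\to\infty$; that is, there exist absolute constants $c,C>0$ and $n_0$ such that $c\,n^2\le ex_3(D_2^3,n)\le C\,n^2$ for all $n\ge n_0$.
   Context: A geometric $3$-hypergraph in $3$-space is a pair $H=(V,E)$, where $V$ is a finite set of points in general position in $\mathbb{R}^3$ (no four on a plane and no three on a line) and $E$ is a set of closed triangles ($2$-dimensional simplices), each being the convex hull of some $3$-element subset of $V$. $H$ is $n$-vertex if $|V|=n$. Two edges are disjoint if the corresponding closed triangles have no point in common (as subsets of $\mathbb{R}^3$). *)

theory Defs
  imports "HOL-Analysis.Analysis"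
begin

definition general_position :: "(real ^ 3) set \<Rightarrow> bool" where
  "general_position V \<longleftrightarrow>
     (\<forall>S \<subseteq> V. card S = 3 \<longrightarrow> \<not> collinear S) \<and>
     (\<forall>S \<subseteq> V. card S = 4 \<longrightarrow> \<not> coplanar S)"

definition geometric_hypergraph :: "(real ^ 3) set \<Rightarrow> (real ^ 3) set set \<Rightarrow> bool" where
  "geometric_hypergraph V E \<longleftrightarrow>
     finite V \<and> general_position V \<and>
     (\<forall>t \<in> E. \<exists>S \<subseteq> V. card S = 3 \<and> t = convex hull S)"

definition has_two_disjoint_edges :: "(real ^ 3) set set \<Rightarrow> bool" where
  "has_two_disjoint_edges E \<longleftrightarrow> (\<exists>s \<in> E. \<exists>t \<in> E. s \<noteq> t \<and> s \<inter> t = {})"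

text \<open>
  The maximum is over a finite set (an \<open>n\<close>-vertex hypergraph has at most \<open>n choose 3\<close> edges),
  which is nonempty: there are \<open>n\<close> points in general position, and \<open>E = {}\<close> is allowed.
\<close>
definition ex3_disjoint :: "nat \<Rightarrow> nat" where
  "ex3_disjoint n =
     Max {card E | V E. geometric_hypergraph V E \<and> card V = n \<and> \<not> has_two_disjoint_edges E}"

end

theory Submission
  imports Defs
begin

text \<open>
  For the upper bound \<open>2 n\<^sup>2\<close>, call an edge \<open>pqr\<close> bad for the ordered pair \<open>(p, q)\<close> if no edge
  \<open>pqx\<close> has \<open>x\<close> on the positive side of the oriented plane \<open>pqr\<close>. By general position
  every ordered pair has at most one bad edge; delete these. Do the same again
  among the remaining edges \<open>cab\<close> with \<open>c\<close> a lowest vertex, charging to \<open>(c, a)\<close>. If an edge \<open>cab\<close>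
  survives both deletions, there are edges \<open>cax\<close> and \<open>cby\<close> leaving \<open>cab\<close> on opposite sides. Seen
  from the lowest vertex \<open>c\<close> they are disjoint segments in a plane, so that one of them, say \<open>by\<close>,
  spans with \<open>c\<close> a plane having \<open>a\<close> and \<open>x\<close> strictly on one side. By the first deletion there is
  an edge \<open>byw\<close> with \<open>w\<close> strictly on the other side, and it is disjoint from \<open>cax\<close>.

  The lower bound is the star of a vertex on the moment curve.
\<close>

section \<open>Orientation of four points in space\<close>

text \<open>The determinant of \<open>q - p\<close>, \<open>r - p\<close>, \<open>s - p\<close>; its
  sign tells on which side of the oriented plane \<open>pqr\<close> the point \<open>s\<close>
  lies.\<close>

definition orient :: "real ^ 3 \<Rightarrow> real ^ 3 \<Rightarrow> real ^ 3 \<Rightarrow> real ^ 3 \<Rightarrow> real" where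
  "orient p q r s = cross3 (q - p) (r - p) \<bullet> (s - p)"

lemmas orient_expand = orient_def cross3_simps

lemma orient_degenerate [simp]:
  "orient p p r s = 0" "orient p q p s = 0" "orient p q q s = 0"
  "orient p q r p = 0" "orient p q r q = 0" "orient p q r r = 0"
  by (simp_all add: orient_expand)

lemma orient_swap12: "orient q p r s = - orient p q r s"
  and orient_swap23: "orient p r q s = - orient p q r s"
  and orient_swap34: "orient p q s r = - orient p q r s"
  by (simp_all add: orient_expand)

lemma orient_convex_combination:
  assumes "u + v + w = 1"
  shows "orient p q r (u *\<^sub>R a + v *\<^sub>R b + w *\<^sub>R c) = u * orient p q r a + v * orient p q r b + w * orient p q r c"
proof -
  have "(u *\<^sub>R a + v *\<^sub>R b + w *\<^sub>R c) - p = u *\<^sub>R (a - p) + v *\<^sub>R (b - p) + w *\<^sub>R (c - p)"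
    using assms by (simp add: algebra_simps flip: scaleR_add_left)
  then show ?thesis
    by (simp add: orient_def inner_right_distrib)
qed

text \<open>A zero value puts all four points on the plane through \<open>p\<close> with normal
  \<open>?N\<close>, which is nonzero since \<open>p\<close>, \<open>q\<close>, \<open>r\<close> are
  not collinear; counting dimensions, \<open>s\<close> lies in their affine hull.\<close>

lemma orient_nonzero:
  assumes gp: "general_position V" and "{p, q, r, s} \<subseteq> V" "distinct [p, q, r, s]"
  shows "orient p q r s \<noteq> 0"
proof
  assume 0: "orient p q r s = 0"
  let ?N = "cross3 (q - p) (r - p)"
  have "card {p, q, r} = 3" "card {p, q, r, s} = 4"
    using assms(3) by auto
  then have nc: "\<not> collinear {p, q, r}" and np: "\<not> coplanar {p, q, r, s}"
    using gp assms(2) by (simp_all add: general_position_def)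
  have "collinear {q, p, r} \<longleftrightarrow> collinear {0, q - p, r - p}"
    by (subst collinear_3) auto
  then have "?N \<noteq> 0"
    using nc by (simp add: cross_eq_0 insert_commute)
  then have "aff_dim {x. ?N \<bullet> x = ?N \<bullet> p} = 2"
    by (simp add: aff_dim_hyperplane)
  moreover have "?N \<bullet> (q - p) = 0" "?N \<bullet> (r - p) = 0" "?N \<bullet> (s - p) = 0"
    using 0 by (simp_all add: orient_def dot_cross_self)
  then have "{s, p, q, r} \<subseteq> {x. ?N \<bullet> x = ?N \<bullet> p}"
    by (simp add: inner_diff_right)
  ultimately have "aff_dim (insert s {p, q, r}) \<le> 2"
    by (metis aff_dim_subset)
  moreover have "aff_dim {p, q, r} > 1"
    using nc by (simp add: collinear_aff_dim)
  ultimately have "s \<in> affine hull {p, q, r}"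
    by (auto simp: aff_dim_insert split: if_splits)
  then have "{p, q, r, s} \<subseteq> affine hull {p, q, r}"
    by (auto intro: hull_inc)
  then show False
    using np unfolding coplanar_def by blast
qed

section \<open>Separating two triangles by a plane\<close>

text \<open>The plane \<open>cpq\<close> separates the triangles weakly: one touches it only in
  \<open>c\<close>, the other only along the segment \<open>pq\<close>. A common point would be
  \<open>c\<close> lying on \<open>pq\<close>, making \<open>orient c p q w\<close> vanish.\<close>

lemma disjoint_triangles:
  assumes neg: "orient c p q r < 0" "orient c p q s < 0" and pos: "orient c p q w > 0"
  shows "convex hull {c, r, s} \<inter> convex hull {p, q, w} = {}"
proof (rule ccontr)
  assume "convex hull {c, r, s} \<inter> convex hull {p, q, w} \<noteq> {}"
  then obtain z where "z \<in> convex hull {c, r, s}" "z \<in> convex hull {p, q, w}"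
    by blast
  then obtain u1 u2 u3 v1 v2 v3 where
    u: "z = u1 *\<^sub>R c + u2 *\<^sub>R r + u3 *\<^sub>R s" "0 \<le> u1" "0 \<le> u2" "0 \<le> u3" "u1 + u2 + u3 = 1" and
    v: "z = v1 *\<^sub>R p + v2 *\<^sub>R q + v3 *\<^sub>R w" "0 \<le> v1" "0 \<le> v2" "0 \<le> v3" "v1 + v2 + v3 = 1"
    unfolding convex_hull_3 by blast
  have "orient c p q z = u2 * orient c p q r + u3 * orient c p q s"
    unfolding u(1) orient_convex_combination[OF u(5)] by simp
  moreover have "orient c p q z = v3 * orient c p q w"
    unfolding v(1) orient_convex_combination[OF v(5)] by simp
  ultimately have oz: "u2 * orient c p q r + u3 * orient c p q s = v3 * orient c p q w"
    by simp
  have "u2 * orient c p q r \<le> 0" "u3 * orient c p q s \<le> 0" "v3 * orient c p q w \<ge> 0"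
    using u v neg pos by (auto intro: mult_nonneg_nonpos)
  then have "u2 * orient c p q r = 0" "u3 * orient c p q s = 0" "v3 * orient c p q w = 0"
    using oz by linarith+
  then have "u2 = 0" "u3 = 0" "v3 = 0"
    using neg pos by auto
  then have "c = v1 *\<^sub>R p + v2 *\<^sub>R q" "v1 + v2 = 1"
    using u v by simp_all
  then have "collinear {p, c, q}"
    unfolding collinear_3_expand by (metis add_diff_cancel_left')
  then have "collinear {0, p - c, q - c}"
    by (subst (asm) collinear_3) auto
  then have "cross3 (p - c) (q - c) = 0"
    by (simp add: cross_eq_0)
  then show False
    using pos by (simp add: orient_def)
qed

text \<open>The sign hypotheses say that \<open>x\<close> and \<open>y\<close> lie on opposite sides of the plane \<open>cab\<close>.\<close>

lemma separated_in_link: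
  assumes low: "c $ 1 \<le> a $ 1" "c $ 1 \<le> b $ 1" "c $ 1 \<le> x $ 1" "c $ 1 \<le> y $ 1"
    and x: "orient c a b x > 0" and y: "orient c b a y > 0"
    and nz: "orient c b y x \<noteq> 0" "orient c a x y \<noteq> 0"
  shows "orient c b y x < 0 \<or> orient c a x y < 0"
proof (rule ccontr)
  assume "\<not> ?thesis"
  with nz have pos: "orient c b y x > 0" "orient c a x y > 0" by auto
  have x': "- orient c a x b > 0"
    using x orient_swap34[of c a b x] by simp
  have y': "- orient c b y a > 0"
    using y orient_swap34[of c b a y] by simp
  \<comment> \<open>Cramer's rule for the four vectors from \<open>c\<close>, read in the first coordinate\<close>
  have cramer: "orient c b y x * (a$1 - c$1) + - orient c b y a * (x$1 - c$1)
      + orient c a x y * (b$1 - c$1) + - orient c a x b * (y$1 - c$1) = 0"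
    by (simp add: orient_expand)
  have "orient c b y x * (a$1 - c$1) \<ge> 0" "- orient c b y a * (x$1 - c$1) \<ge> 0"
    "orient c a x y * (b$1 - c$1) \<ge> 0" "- orient c a x b * (y$1 - c$1) \<ge> 0"
    using pos x' y' low by (intro mult_nonneg_nonneg; linarith)+
  with cramer have "orient c b y x * (a$1 - c$1) = 0" "- orient c b y a * (x$1 - c$1) = 0"
    "orient c a x y * (b$1 - c$1) = 0"
    by linarith+
  \<comment> \<open>Ties for the lowest vertex are allowed, so the dependence is not yet absurd: it
    forces \<open>a\<close>, \<open>b\<close>, \<open>x\<close> down to the height of
    \<open>c\<close>, and then the four points are coplanar.\<close>
  with pos y' have "a$1 = c$1" "x$1 = c$1" "b$1 = c$1"
    by auto
  then have "orient c a b x = 0"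
    by (simp add: orient_expand)
  with x show False by simp
qed

section \<open>Counting deleted edges and the upper bound\<close>

text \<open>Exchanging the last two points flips the sign of \<open>orient\<close>, so of two
  candidates over the same pair \<open>(p, q)\<close> one extends the other. \<open>Q\<close> is a
  parameter because both deletions are instances.\<close>

lemma card_unextendable:
  assumes V: "finite V" "general_position V"
    and Q: "\<And>p q r. Q p q r \<Longrightarrow> {p, q, r} \<subseteq> V \<and> distinct [p, q, r]"
  shows "card {{p, q, r} | p q r. Q p q r \<and> \<not> (\<exists>x. Q p q x \<and> orient p q r x > 0)} \<le> card V ^ 2"
proof -
  define R where "R p q = {r. Q p q r \<and> \<not> (\<exists>x. Q p q x \<and> orient p q r x > 0)}" for p q
  have R: "R p q \<subseteq> V" for p q
    using Q by (auto simp: R_def)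
  have "r = s" if "r \<in> R p q" "s \<in> R p q" for p q r s
  proof (rule ccontr)
    assume "r \<noteq> s"
    have "Q p q r" "Q p q s"
      using that by (auto simp: R_def)
    with \<open>r \<noteq> s\<close> Q have "orient p q r s \<noteq> 0"
      by (intro orient_nonzero[OF V(2)]) fastforce+
    moreover have "orient p q s r = - orient p q r s"
      by (rule orient_swap34)
    ultimately show False
      using that by (auto simp: R_def) (metis neg_0_less_iff_less linorder_neqE)
  qed
  moreover have fin_R: "finite (R p q)" for p q
    by (rule finite_subset[OF R V(1)])
  ultimately have card_R: "card (R p q) \<le> 1" for p q
    by (simp add: card_le_Suc0_iff_eq)
  let ?U = "\<Union>(p, q)\<in>V \<times> V. (\<lambda>r. {p, q, r}) ` R p q"
  have "{{p, q, r} | p q r. Q p q r \<and> \<not> (\<exists>x. Q p q x \<and> orient p q r x > 0)} \<subseteq> ?U"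
  proof clarify
    fix p q r
    assume "Q p q r" "\<not> (\<exists>x. Q p q x \<and> orient p q r x > 0)"
    then have "p \<in> V" "q \<in> V" "r \<in> R p q"
      using Q[of p q r] by (auto simp: R_def)
    then show "{p, q, r} \<in> ?U"
      by blast
  qed
  moreover have "finite ?U"
    using V(1) fin_R by auto
  ultimately have "card {{p, q, r} | p q r. Q p q r \<and> \<not> (\<exists>x. Q p q x \<and> orient p q r x > 0)} \<le> card ?U"
    by (intro card_mono)
  also have "\<dots> \<le> (\<Sum>(p, q)\<in>V \<times> V. card ((\<lambda>r. {p, q, r}) ` R p q))"
    using card_UN_le[of "V \<times> V" "\<lambda>(p, q). (\<lambda>r. {p, q, r}) ` R p q"] V(1)
    by (simp add: case_prod_unfold)
  also have "\<dots> \<le> (\<Sum>(p, q)\<in>V \<times> V. 1)"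
  proof (intro sum_mono, clarsimp)
    fix p q
    show "card ((\<lambda>r. {p, q, r}) ` R p q) \<le> Suc 0"
      using card_R[of p q] card_image_le[OF fin_R[of p q], of "\<lambda>r. {p, q, r}"]
      by simp
  qed
  also have "\<dots> = card V ^ 2"
    by (simp add: case_prod_unfold card_cartesian_product power2_eq_square)
  finally show ?thesis .
qed

lemma min_coordinate_triple:
  fixes T :: "(real ^ 3) set"
  assumes "card T = 3"
  obtains c a b where "T = {c, a, b}" "distinct [c, a, b]" "c $ 1 \<le> a $ 1" "c $ 1 \<le> b $ 1"
proof -
  have fin: "finite T" "T \<noteq> {}"
    using assms by (auto intro: card_ge_0_finite)
  obtain c where c: "c \<in> T" "\<And>z. z \<in> T \<Longrightarrow> c $ 1 \<le> z $ 1"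
    using ex_min_if_finite[of "(\<lambda>z. z $ 1) ` T"] fin by (auto simp: not_less)
  have "card (T - {c}) = 2"
    using c assms fin by simp
  then obtain a b where "T - {c} = {a, b}" "a \<noteq> b"
    by (auto simp: card_2_iff)
  with c that[of c a b] show thesis
    by (metis Diff_iff distinct_length_2_or_more distinct_singleton insertCI insert_Diff singletonD)
qed

lemma card_edges_le:
  assumes H: "geometric_hypergraph V E" and nd: "\<not> has_two_disjoint_edges E"
  shows "card E \<le> 2 * card V ^ 2"
proof -
  have V: "finite V" "general_position V"
    using H by (auto simp: geometric_hypergraph_def)
  \<comment> \<open>Vertex triples replace triangles, since \<open>orient\<close> acts on vertices;
    \<open>convex hull\<close> maps \<open>\<T>\<close> onto \<open>E\<close>.\<close>
  define \<T> where "\<T> = {T. T \<subseteq> V \<and> card T = 3 \<and> convex hull T \<in> E}"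
  define Q1 where "Q1 p q r \<longleftrightarrow> {p, q, r} \<in> \<T>" for p q r
  define B1 where "B1 = {{p, q, r} | p q r. Q1 p q r \<and> \<not> (\<exists>x. Q1 p q x \<and> orient p q r x > 0)}"
  \<comment> \<open>Restricting to \<open>\<T> - B1\<close> ensures that the extensions found in the
    second round survive the first deletion as well.\<close>
  define Q2 where "Q2 p q r \<longleftrightarrow> {p, q, r} \<in> \<T> - B1 \<and> p $ 1 \<le> q $ 1 \<and> p $ 1 \<le> r $ 1" for p q r
  define B2 where "B2 = {{p, q, r} | p q r. Q2 p q r \<and> \<not> (\<exists>x. Q2 p q x \<and> orient p q r x > 0)}"
  have \<T>D: "{p, q, r} \<subseteq> V \<and> distinct [p, q, r]" if "{p, q, r} \<in> \<T>" for p q r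
    using that by (auto simp: \<T>_def card_insert_if split: if_splits)
  have fin: "finite \<T>"
    using V(1) by (auto simp: \<T>_def intro: finite_subset[of _ "Pow V"])
  have nodisj: "convex hull S \<inter> convex hull T \<noteq> {}" if "S \<in> \<T>" "T \<in> \<T>" for S T
  proof
    assume *: "convex hull S \<inter> convex hull T = {}"
    have "S \<noteq> {}" using that by (auto simp: \<T>_def)
    then have "convex hull S \<noteq> {}" by simp
    with * have "convex hull S \<noteq> convex hull T" by auto
    with * that nd show False
      by (auto simp: \<T>_def has_two_disjoint_edges_def)
  qed
  \<comment> \<open>The first deletion is applied to the side \<open>pq\<close> opposite
    \<open>c\<close>; a cyclic shift of \<open>c\<close>, \<open>p\<close>, \<open>q\<close>
    preserves \<open>orient\<close>.\<close>
  have extend: "\<exists>w. {p, q, w} \<in> \<T> \<and> orient c p q w > 0" if "{c, p, q} \<in> \<T> - B1" for c p q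
  proof -
    have "Q1 p q c" using that by (simp add: Q1_def insert_commute)
    moreover have "{p, q, c} \<notin> B1" using that by (simp add: insert_commute)
    ultimately obtain w where "Q1 p q w" "orient p q c w > 0"
      unfolding B1_def by blast
    moreover have "orient c p q w = orient p q c w"
      using orient_swap12[of p c q w] orient_swap23[of p q c w] by simp
    ultimately show ?thesis by (auto simp: Q1_def)
  qed
  have separate: False if "{c, p, q} \<in> \<T> - B1" "{c, r, s} \<in> \<T>"
      "orient c p q r < 0" "orient c p q s < 0" for c p q r s
    using extend[OF that(1)] disjoint_triangles[OF that(3,4)] nodisj[OF that(2)] by blast
  have "\<T> \<subseteq> B1 \<union> B2"
  proof
    fix T assume "T \<in> \<T>"
    show "T \<in> B1 \<union> B2"
    proof (rule ccontr)
      assume T: "T \<notin> B1 \<union> B2"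
      have "card T = 3" using \<open>T \<in> \<T>\<close> by (simp add: \<T>_def)
      then obtain c a b where cab: "T = {c, a, b}" "distinct [c, a, b]" "c $ 1 \<le> a $ 1" "c $ 1 \<le> b $ 1"
        by (rule min_coordinate_triple)
      have "T = {c, b, a}" using cab by auto
      \<comment> \<open>Both orders of the two upper vertices are admissible, and they orient the
        plane oppositely, so \<open>x\<close> and \<open>y\<close> come out on different
        sides.\<close>
      have "Q2 c a b" "Q2 c b a"
        using T \<open>T \<in> \<T>\<close> cab \<open>T = {c, b, a}\<close> by (auto simp: Q2_def)
      have "{c, a, b} \<notin> B2" "{c, b, a} \<notin> B2"
        using T cab(1) \<open>T = {c, b, a}\<close> by auto
      then have "\<exists>x. Q2 c a x \<and> orient c a b x > 0" "\<exists>y. Q2 c b y \<and> orient c b a y > 0"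
        using \<open>Q2 c a b\<close> \<open>Q2 c b a\<close> unfolding B2_def mem_Collect_eq by metis+
      then obtain x y where x: "Q2 c a x" "orient c a b x > 0" and y: "Q2 c b y" "orient c b a y > 0"
        by auto
      have mem: "{c, a, x} \<in> \<T> - B1" "{c, b, y} \<in> \<T> - B1"
        using x y by (auto simp: Q2_def)
      have "x \<noteq> y"
        using x(2) y(2) orient_swap23[of c b a y] by auto
      moreover have "x \<noteq> b" "y \<noteq> a"
        using x(2) y(2) by auto
      ultimately have "distinct [c, b, y, x]" "distinct [c, a, x, y]"
        "{c, b, y, x} \<subseteq> V" "{c, a, x, y} \<subseteq> V"
        using \<T>D[of c a x] \<T>D[of c b y] mem cab(2) by auto
      then have nz: "orient c b y x \<noteq> 0" "orient c a x y \<noteq> 0"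
        using orient_nonzero[OF V(2)] by blast+
      have neg: "orient c a x b < 0" "orient c b y a < 0"
        using x(2) y(2) orient_swap34[of c a b x] orient_swap34[of c b a y] by auto
      have "orient c b y x < 0 \<or> orient c a x y < 0"
        using x y nz cab by (intro separated_in_link[of c a b x y]) (auto simp: Q2_def)
      \<comment> \<open>Either plane \<open>cby\<close> has \<open>a\<close> and \<open>x\<close> on
        its negative side, or plane \<open>cax\<close> has \<open>b\<close> and \<open>y\<close>
        there.\<close>
      then show False
        using separate[of c b y a x] separate[of c a x b y] mem neg by blast
    qed
  qed
  moreover have "B1 \<subseteq> \<T>" "B2 \<subseteq> \<T>"
    by (auto simp: B1_def B2_def Q1_def Q2_def)
  ultimately have "card \<T> \<le> card B1 + card B2"
    using fin by (metis card_Un_le card_mono finite_UnI finite_subset order_trans)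
  also have "card B1 \<le> card V ^ 2"
    unfolding B1_def by (rule card_unextendable[OF V]) (use \<T>D in \<open>auto simp: Q1_def\<close>)
  also have "card B2 \<le> card V ^ 2"
    unfolding B2_def by (rule card_unextendable[OF V]) (use \<T>D in \<open>auto simp: Q2_def\<close>)
  finally have "card \<T> \<le> 2 * card V ^ 2" by simp
  moreover have "E \<subseteq> (\<lambda>T. convex hull T) ` \<T>"
    using H by (auto simp: geometric_hypergraph_def \<T>_def)
  then have "card E \<le> card \<T>"
    using fin by (rule surj_card_le[rotated])
  ultimately show ?thesis by simp
qed

section \<open>The moment curve and the lower bound\<close>

definition moment_curve :: "real \<Rightarrow> real ^ 3" where
  "moment_curve t = vector [t, t ^ 2, t ^ 3]"

lemma inj_moment_curve: "inj moment_curve"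
  by (rule injI) (metis moment_curve_def vector_3(1))

text \<open>The parameters at which the curve meets a plane are roots of a nonzero polynomial of
  degree at most 3, so a plane contains at most three points of it.\<close>

lemma moment_curve_aff_dim:
  assumes "S \<subseteq> range moment_curve" "card S = 4"
  shows "aff_dim S = 3"
proof (rule ccontr)
  assume "aff_dim S \<noteq> 3"
  then have "aff_dim S < DIM(real ^ 3)"
    using aff_dim_le_DIM[of S] by simp
  then obtain n d where n: "n \<noteq> 0" "S \<subseteq> {x. n \<bullet> x = d}"
    by (rule aff_lowdim_subset_hyperplane)
  define coef :: "nat \<Rightarrow> real" where
    "coef = (\<lambda>i. if i = 0 then - d else if i = 1 then n $ 1 else if i = 2 then n $ 2 else n $ 3)"
  have "\<exists>k\<le>3. coef k \<noteq> 0"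
  proof (rule ccontr)
    assume "\<not> ?thesis"
    then have "coef 1 = 0" "coef 2 = 0" "coef 3 = 0" by auto
    with n(1) show False by (simp add: coef_def vec_eq_iff forall_3)
  qed
  then have roots: "finite {z. (\<Sum>i\<le>3. coef i * z ^ i) = 0}" "card {z. (\<Sum>i\<le>3. coef i * z ^ i) = 0} \<le> 3"
    using polyfun_rootbound by blast+
  have "(\<Sum>i\<le>3. coef i * z ^ i) = n \<bullet> moment_curve z - d" for z
    by (simp add: numeral_3_eq_3 coef_def moment_curve_def inner_vec_def sum_3)
      (simp add: numeral_2_eq_2)
  then have "S \<subseteq> moment_curve ` {z. (\<Sum>i\<le>3. coef i * z ^ i) = 0}"
    using assms(1) n(2) by fastforce
  then have "card S \<le> 3"
    using roots surj_card_le le_trans by blast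
  with assms(2) show False by simp
qed

lemma general_position_moment_curve:
  assumes "V \<subseteq> range moment_curve"
  shows "general_position V"
  unfolding general_position_def
proof (intro conjI allI impI notI)
  fix S assume S: "S \<subseteq> V" "card S = 3" "collinear S"
  \<comment> \<open>A further point of the curve reduces triples to the case of four points: it
    raises the dimension by at most one, from at most 1 to at most 2.\<close>
  have "infinite (range moment_curve)"
    using inj_moment_curve by (simp add: finite_image_iff infinite_UNIV_char_0)
  moreover have "finite S" using S by (auto intro: card_ge_0_finite)
  ultimately obtain s where s: "s \<in> range moment_curve" "s \<notin> S"
    by (meson finite_subset subsetI)
  then have "aff_dim (insert s S) = 3"
    using S assms \<open>finite S\<close> by (intro moment_curve_aff_dim) auto
  moreover have "aff_dim S \<le> 1"
    using S by (simp add: collinear_aff_dim)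
  ultimately show False
    by (auto simp: aff_dim_insert split: if_splits)
next
  fix S assume S: "S \<subseteq> V" "card S = 4" "coplanar S"
  then obtain u v w where "S \<subseteq> affine hull {u, v, w}"
    by (auto simp: coplanar_def)
  then have "aff_dim S \<le> aff_dim {u, v, w}"
    by (metis aff_dim_affine_hull aff_dim_subset)
  also have "\<dots> \<le> int (card {u, v, w}) - 1"
    by (intro aff_dim_le_card) auto
  also have "\<dots> \<le> 2"
    by (simp add: card_insert_if)
  finally show False
    using S assms moment_curve_aff_dim[of S] by auto
qed

text \<open>The vertices are recovered as the extreme points of the triangle. Hence counting edges
  of the star amounts to counting triples.\<close>

lemma inj_on_convex_hull_triples:
  assumes "general_position V"
  shows "inj_on (\<lambda>S. convex hull S) {S. S \<subseteq> V \<and> card S = 3}"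
proof (rule inj_on_inverseI)
  fix S assume "S \<in> {S. S \<subseteq> V \<and> card S = 3}"
  then have S: "S \<subseteq> V" "card S = 3" by auto
  then have "\<not> collinear S"
    using assms by (auto simp: general_position_def)
  moreover obtain a b c where "S = {a, b, c}" "distinct [a, b, c]"
    using S(2) by (auto simp: card_3_iff)
  ultimately have "\<not> affine_dependent S"
    by (simp add: collinear_3_eq_affine_dependent)
  then show "{x. x extreme_point_of (convex hull S)} = S"
    by (simp add: extreme_point_of_convex_hull_affine_independent)
qed

lemma star_hypergraph:
  obtains V E where "geometric_hypergraph V E" "card V = Suc n"
    "\<not> has_two_disjoint_edges E" "card E = n choose 2"
proof
  define v where "v i = moment_curve (real i)" for i
  define V where "V = v ` {..n}"
  \<comment> \<open>All triples through \<open>v 0\<close>, one for each pair of the other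
    \<open>n\<close> points; the common vertex makes any two triangles meet.\<close>
  define \<S> where "\<S> = (\<lambda>S. insert (v 0) S) ` {S. S \<subseteq> v ` {1..n} \<and> card S = 2}"
  define E where "E = (\<lambda>S. convex hull S) ` \<S>"
  have inj: "inj v"
    using inj_moment_curve by (metis v_def injD injI of_nat_eq_iff)
  have "{..n} = insert 0 {1..n}"
    by auto
  then have V_eq: "V = insert (v 0) (v ` {1..n})"
    by (simp add: V_def)
  have v0: "v 0 \<notin> v ` {1..n}"
    using inj by (auto dest: injD)
  have gp: "general_position V"
    by (rule general_position_moment_curve) (auto simp: V_def v_def)
  have \<S>: "\<S> \<subseteq> {S. S \<subseteq> V \<and> card S = 3}"
  proof
    fix T assume "T \<in> \<S>"
    then obtain S where S: "T = insert (v 0) S" "S \<subseteq> v ` {1..n}" "card S = 2"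
      by (auto simp: \<S>_def)
    then have "finite S" "v 0 \<notin> S"
      using v0 finite_subset[of S "v ` {1..n}"] by auto
    with S show "T \<in> {S. S \<subseteq> V \<and> card S = 3}"
      by (auto simp: V_eq)
  qed
  show "geometric_hypergraph V E"
    using gp \<S> by (auto simp: geometric_hypergraph_def E_def V_def)
  show "card V = Suc n"
    using inj by (simp add: V_def card_image inj_on_subset)
  show "\<not> has_two_disjoint_edges E"
  proof -
    have "v 0 \<in> t" if "t \<in> E" for t
      using that by (auto simp: E_def \<S>_def hull_inc)
    then show ?thesis by (auto simp: has_two_disjoint_edges_def)
  qed
  have "card E = card \<S>"
    unfolding E_def by (intro card_image inj_on_subset[OF inj_on_convex_hull_triples[OF gp] \<S>])
  also have "\<dots> = card {S. S \<subseteq> v ` {1..n} \<and> card S = 2}"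
    unfolding \<S>_def
  proof (intro card_image inj_onI)
    fix S T assume "S \<in> {S. S \<subseteq> v ` {1..n} \<and> card S = 2}" "T \<in> {S. S \<subseteq> v ` {1..n} \<and> card S = 2}"
      and eq: "insert (v 0) S = insert (v 0) T"
    then have "v 0 \<notin> S" "v 0 \<notin> T" using v0 by blast+
    with eq show "S = T" by (simp add: insert_ident)
  qed
  also have "\<dots> = card (v ` {1..n}) choose 2"
    by (intro n_subsets) auto
  also have "card (v ` {1..n}) = n"
    using inj by (simp add: card_image inj_on_subset)
  finally show "card E = n choose 2" .
qed

section \<open>The quadratic bounds\<close>

theorem theorem1p5:
  shows "\<exists>(c::real) (C::real) (n0::nat). c > 0 \<and> C > 0 \<and>
    (\<forall>n \<ge> n0. c * real n ^ 2 \<le> real (ex3_disjoint n) \<and>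
                real (ex3_disjoint n) \<le> C * real n ^ 2)"
proof -
  have bounds: "1 / 8 * real n ^ 2 \<le> real (ex3_disjoint n) \<and> real (ex3_disjoint n) \<le> 2 * real n ^ 2"
    if "n \<ge> 4" for n
  proof
    define M where "M = {card E | V E. geometric_hypergraph V E \<and> card V = n \<and> \<not> has_two_disjoint_edges E}"
    have ex: "ex3_disjoint n = Max M"
      by (simp add: ex3_disjoint_def M_def)
    have le: "k \<le> 2 * n ^ 2" if "k \<in> M" for k
      using that card_edges_le by (auto simp: M_def)
    \<comment> \<open>\<open>Max\<close> is informative only on a finite nonempty set; the uniform
      bound gives finiteness and the star a member.\<close>
    then have fin: "finite M"
      by (auto simp: finite_nat_set_iff_bounded_le)
    define m where "m = n - 1"
    have m: "n = Suc m" "m \<ge> 3"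
      using that by (auto simp: m_def)
    have star: "m choose 2 \<in> M"
    proof -
      obtain V E where "geometric_hypergraph V E" "card V = Suc m"
        "\<not> has_two_disjoint_edges E" "card E = m choose 2"
        by (rule star_hypergraph)
      then show ?thesis
        unfolding M_def m(1) by (metis (mono_tags, lifting) mem_Collect_eq)
    qed
    then have "ex3_disjoint n \<le> 2 * n ^ 2"
      unfolding ex using fin le by (metis Max_in empty_iff)
    then show "real (ex3_disjoint n) \<le> 2 * real n ^ 2"
      by (metis of_nat_le_iff of_nat_mult of_nat_numeral of_nat_power)
    have "1 / 8 * real n ^ 2 \<le> real m * (real m - 1) / 2"
    proof -
      \<comment> \<open>After multiplication by 8 the claim reads
        \<open>3 * m^2 - 6 * m - 1 \<ge> 0\<close>, and its left side is this product plus 8. The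
        factor \<open>m - 3\<close> is the reason for \<open>n \<ge> 4\<close>.\<close>
      have "(real m - 3) * (3 * real m + 3) \<ge> 0"
        using m(2) by (intro mult_nonneg_nonneg) auto
      then show ?thesis
        using m(2) by (simp add: m(1) power2_eq_square algebra_simps)
    qed
    also have "\<dots> = real (m choose 2)"
      using binomial_gbinomial[of m 2, where 'a = real]
      by (simp add: gbinomial_prod_rev numeral_2_eq_2)
    also have "\<dots> \<le> real (ex3_disjoint n)"
      unfolding ex using fin star by simp
    finally show "1 / 8 * real n ^ 2 \<le> real (ex3_disjoint n)" .
  qed
  show ?thesis
    by (rule exI[of _ "1 / 8"], rule exI[of _ 2], rule exI[of _ 4]) (use bounds in auto)
qed

end
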